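(* Let $X$ be any uncountable Polish space. Then $$\mathfrak{sp}(\mathrm{Borel}) = \{\kappa > \aleph_0 : \text{there is a partition of } X \text{ into } \kappa \text{ Borel sets}\}.$$
   Context: A partition of a set is a family of pairwise disjoint nonempty subsets whose union is the whole set. The Borel partition spectrum is $\mathfrak{sp}(\mathrm{Borel}) = \{|\mathcal P| : \mathcal P \text{ is a partition of } \mathbb{R} \text{ into uncountably many Borel sets}\}$. *)

theory Defs
  imports "HOL-Analysis.Analysis" "HOL-Library.Disjoint_Sets"
begin

unbundle cardinal_syntax

definition Polish_space :: "'a topology \<Rightarrow> bool" where
  "Polish_space X \<longleftrightarrow> separable_space X \<and> completely_metrizable_space X"

definition Borel_sets :: "'a topology \<Rightarrow> 'a set set" where
  "Borel_sets X = sigma_sets (topspace X) {U. openin X U}"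

definition Borel_partition :: "'a topology \<Rightarrow> 'a set set \<Rightarrow> bool" where
  "Borel_partition X P \<longleftrightarrow> partition_on (topspace X) P \<and> P \<subseteq> Borel_sets X"

lemma Borel_sets_euclidean: "Borel_sets euclidean = sets borel"
  by (simp add: Borel_sets_def sets_borel)

(* A cardinal is represented by the cardinal orders (initial well-orders) \<kappa> :: 'k rel
   having that cardinality, and a set of cardinals by the set of all its representatives on
   'k.  Since 'k is an arbitrary type (for instance "real set", on which the order |P| itself
   lives), no cardinal is lost when a statement is made for every 'k. *)
definition sp_Borel :: "'k rel set" where
  "sp_Borel = {\<kappa>. Card_order \<kappa> \<and>
     (\<exists>P. Borel_partition (euclidean :: real topology) P \<and> uncountable P \<and> |P| =o \<kappa>)}"

end

theory Submission
  imports Defs "HOL-Library.Countable_Set_Type"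
begin

text \<open>No Borel isomorphism is needed: a Borel surjection \<open>F : X \<rightarrow> Y\<close> pulls a Borel partition
  of \<open>Y\<close> back to one of \<open>X\<close> with equally many pieces, so it suffices that every uncountable
  Polish space has a Borel surjection onto every nonempty Polish space. A Cantor scheme of open
  sets in \<open>X\<close> gives a sequence of open sets realising every \<open>0/1\<close> sequence as a membership
  pattern; decoding such a pattern as a sequence of indices into a countable dense subset of \<open>Y\<close>,
  and that sequence as its limit, gives the surjection.\<close>

section \<open>Condensation points and splitting of open sets\<close>

text \<open>Cantor-Bendixson argument: each such point lies in a ball with centre in
  \<open>D\<close> and rational radius whose trace on \<open>U\<close> is countable, and there are
  only countably many such balls.\<close>

lemma (in Metric_space) countable_non_condensation_points:
  assumes "countable D" and "mtopology closure_of D = M"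
  shows "countable {x \<in> U \<inter> M. \<exists>r>0. countable (mball x r \<inter> U)}"
proof -
  define \<B> where "\<B> = {B \<in> (\<lambda>(c, q). mball c q \<inter> U) ` (D \<times> \<rat>). countable B}"
  have "countable ((\<lambda>(c, q). mball c q \<inter> U) ` (D \<times> \<rat>))"
    using assms(1) countable_rat by blast
  then have "countable \<B>"
    unfolding \<B>_def by (rule countable_subset[rotated]) blast
  moreover have "countable B" if "B \<in> \<B>" for B using that by (simp add: \<B>_def)
  ultimately have "countable (\<Union>\<B>)"
    using countable_UN[of \<B> "\<lambda>B. B"] by simp
  moreover have "{x \<in> U \<inter> M. \<exists>r>0. countable (mball x r \<inter> U)} \<subseteq> \<Union>\<B>"
  proof clarify
    fix x r assume x: "x \<in> U" "x \<in> M" and r: "r > 0" "countable (mball x r \<inter> U)"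
    \<comment> \<open>With \<open>q\<close> below \<open>r/2\<close>, a ball of radius
      \<open>q\<close> whose centre is within \<open>q\<close> of \<open>x\<close> contains
      \<open>x\<close> and stays inside \<open>mball x r\<close>.\<close>
    obtain q where q: "q \<in> \<rat>" "0 < q" "q < r/2"
      using Rats_dense_in_real[of 0 "r/2"] r by auto
    have "x \<in> mtopology closure_of D" using assms(2) x by simp
    then obtain c where c: "c \<in> D" "c \<in> mball x q"
      using q(2) unfolding metric_closure_of by blast
    have "mball c q \<subseteq> mball x r"
      using c q x commute[of c x] by (intro mball_subset) auto
    then have "countable (mball c q \<inter> U)"
      by (intro countable_subset[OF _ r(2)]) auto
    then have "mball c q \<inter> U \<in> \<B>"
      unfolding \<B>_def using c(1) q(1) by blast
    moreover have "x \<in> mball c q \<inter> U"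
      using x c commute[of c x] by auto
    ultimately show "x \<in> \<Union>\<B>" by blast
  qed
  ultimately show ?thesis by (rule countable_subset[rotated])
qed

text \<open>All but countably many points of \<open>U\<close> are condensation points of
  \<open>U\<close>; small balls around two of them are the required halves. This is the branching
  step of the Cantor scheme.\<close>

lemma (in Metric_space) uncountable_open_split:
  assumes "separable_space mtopology" and U: "openin mtopology U" "uncountable U" and "\<epsilon> > 0"
  obtains V :: "bool \<Rightarrow> 'a set"
  where "\<And>i. openin mtopology (V i)" "\<And>i. uncountable (V i)"
    "\<And>i. mtopology closure_of V i \<subseteq> U" "\<And>i. \<exists>x. V i \<subseteq> mcball x \<epsilon>" "disjnt (V True) (V False)"
proof -
  obtain D where D: "countable D" "mtopology closure_of D = M"
    using assms(1) unfolding separable_space_def by auto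
  have UM: "U \<subseteq> M" using U(1) openin_subset by fastforce
  define S where "S = {x \<in> U \<inter> M. \<exists>r>0. countable (mball x r \<inter> U)}"
  have "countable S"
    unfolding S_def by (rule countable_non_condensation_points[OF D])
  then have unc: "uncountable (U - S)" using U(2) by (simp add: uncountable_minus_countable)
  then obtain x where x: "x \<in> U - S"
    by (metis countable_empty ex_in_conv)
  have "uncountable (U - S - {x})" using unc by (simp add: uncountable_minus_countable)
  then obtain y where y: "y \<in> U - S" "y \<noteq> x"
    by (metis DiffE countable_empty ex_in_conv singletonI)
  obtain r where r: "r > 0" "mcball x r \<subseteq> U"
    using x U(1) unfolding openin_mtopology_mcball by blast
  obtain r' where r': "r' > 0" "mcball y r' \<subseteq> U"
    using y U(1) unfolding openin_mtopology_mcball by blast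
  have "x \<in> M" "y \<in> M" "x \<noteq> y" using x y UM by auto
  then have dpos: "d x y > 0" by simp
  \<comment> \<open>The bounds \<open>r\<close> and \<open>r'\<close> keep the closed balls inside
    \<open>U\<close>, \<open>\<epsilon>\<close> controls the size, and half the distance makes the
    open balls disjoint.\<close>
  define s where "s = min (min r r') (min \<epsilon> (d x y / 2))"
  have s: "s > 0" "s \<le> r" "s \<le> r'" "s \<le> \<epsilon>" "s + s \<le> d x y"
    using r r' dpos assms(4) by (auto simp: s_def)
  define V where "V = (\<lambda>i. mball (if i then x else y) s)"
  have cl: "mtopology closure_of (mball z s) \<subseteq> mcball z s" for z
    by (rule closure_of_minimal[OF mball_subset_mcball closedin_mcball])
  have big: "uncountable (mball z s)" if "z \<in> U - S" for z
  proof
    assume "countable (mball z s)"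
    then have "countable (mball z s \<inter> U)" by (rule countable_subset[rotated]) blast
    with that UM s(1) show False unfolding S_def by blast
  qed
  show ?thesis
  proof
    show "openin mtopology (V i)" for i by (simp add: V_def)
    show "uncountable (V i)" for i using big x y by (simp add: V_def)
    have "mcball x s \<subseteq> U" "mcball y s \<subseteq> U"
      using r r' s mcball_subset_concentric by (meson order_trans)+
    then show "mtopology closure_of V i \<subseteq> U" for i
      using cl[of x] cl[of y] by (auto simp: V_def)
    show "\<exists>x. V i \<subseteq> mcball x \<epsilon>" for i
      unfolding V_def using mball_subset_mcball mcball_subset_concentric[OF s(4)]
      by (meson order_trans)
    show "disjnt (V True) (V False)"
      using disjoint_mball[OF s(5)] by (simp add: V_def)
  qed
qed

section \<open>A Cantor scheme and its independent open sets\<close>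

text \<open>Nodes are indexed by finite bit strings, and \<open>B n\<close> collects the nodes of
  depth \<open>n + 1\<close> whose newest bit is \<open>True\<close>. Completeness puts a point on
  every branch; since nodes of equal depth are disjoint, the sets \<open>B n\<close> containing that
  point spell out the branch.\<close>

lemma (in Metric_space) independent_open_sequence:
  assumes "mcomplete" and sep: "separable_space mtopology" and unc: "uncountable M"
  obtains B :: "nat \<Rightarrow> 'a set"
  where "\<And>n. openin mtopology (B n)" "\<And>b. \<exists>x\<in>M. \<forall>n. x \<in> B n \<longleftrightarrow> b n"
proof -
  define good where "good = (\<lambda>U. openin mtopology U \<and> uncountable U)"
  \<comment> \<open>Requirements on the two children \<open>V True\<close> and
    \<open>V False\<close> of a node \<open>U\<close> at depth \<open>n\<close>.\<close>
  define P where "P = (\<lambda>n U V. (\<forall>i. good (V i) \<and> mtopology closure_of V i \<subseteq> U \<and>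
      (\<exists>x. V i \<subseteq> mcball x (inverse (Suc n)))) \<and> disjnt (V True) (V False))"
  have "\<exists>V. P n U V" if U: "good U" for n U
    using uncountable_open_split[OF sep, of U "inverse (Suc n)"] U unfolding good_def P_def
    by (metis inverse_positive_iff_positive of_nat_0_less_iff zero_less_Suc)
  then obtain ch where ch: "\<And>n U. good U \<Longrightarrow> P n U (ch n U)"
    using that[of "\<lambda>n U. SOME V. P n U V"] by (simp add: someI_ex)
  \<comment> \<open>The newest bit is the head of the list, so the tail names the parent and its
    length is the parent's depth.\<close>
  define node where "node = rec_list M (\<lambda>b s U. ch (length s) U b)"
  have [simp]: "node [] = M" by (simp add: node_def)
  have node_Cons [simp]: "node (b # s) = ch (length s) (node s) b" for b s
    by (simp add: node_def)
  have good: "good (node s)" for s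
  proof (induction s)
    case Nil
    then show ?case using unc by (simp add: good_def)
  next
    case (Cons b s)
    then show ?case using ch[of "node s" "length s"] by (simp add: P_def)
  qed
  have P: "P (length s) (node s) (\<lambda>b. node (b # s))" for s
    using ch[OF good] by simp
  have closure_node: "mtopology closure_of node (b # s) \<subseteq> node s" for b s
    using P[of s] unfolding P_def by blast
  have node_M: "node s \<subseteq> M" for s
    using good[of s] openin_subset unfolding good_def by fastforce
  have node_subset: "node (b # s) \<subseteq> node s" for b s
    using closure_node[of b s] closure_of_subset[of "node (b # s)" mtopology] node_M[of "b # s"]
    by (metis order_trans topspace_mtopology)
  \<comment> \<open>Nodes of equal depth are disjoint: a common point lies in both parents, which
    agree by induction, and siblings are disjoint.\<close>
  have node_inj: "s = t" if "length s = length t" "x \<in> node s" "x \<in> node t" for s t x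
    using that
  proof (induction s t rule: list_induct2)
    case (Cons a s b t)
    have "s = t" using Cons node_subset by blast
    moreover have "a = b"
    proof (rule ccontr)
      assume "a \<noteq> b"
      moreover have "x \<notin> node (True # s) \<or> x \<notin> node (False # s)"
        using P[of s] unfolding P_def disjnt_iff by blast
      ultimately show False
        using Cons.prems \<open>s = t\<close> by (cases a; cases b) (simp_all del: node_Cons)
    qed
    ultimately show ?case by simp
  qed simp
  define B where "B = (\<lambda>n. \<Union>{node (True # s) | s. length s = n})"
  show ?thesis
  proof
    show "openin mtopology (B n)" for n
      unfolding B_def using good good_def by (intro openin_Union) blast
  next
    fix b :: "nat \<Rightarrow> bool"
    \<comment> \<open>The first \<open>n\<close> bits of \<open>b\<close>, reversed to match the
      newest-first indexing of \<open>node\<close>.\<close>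
    define p where "p = (\<lambda>n. rev (map b [0..<n]))"
    have [simp]: "p (Suc n) = b n # p n" "length (p n) = n" for n by (simp_all add: p_def)
    \<comment> \<open>The nested-set form of completeness asks for closed sets, whereas the nodes
      are open.\<close>
    define C where "C = (\<lambda>n. mtopology closure_of node (p n))"
    have "\<Inter>(range C) \<noteq> {}"
    proof (rule assms(1)[unfolded mcomplete_nest, rule_format], intro conjI allI impI)
      show "closedin mtopology (C n)" for n by (simp add: C_def)
      show "C n \<noteq> {}" for n
        using good[of "p n"] node_M unfolding good_def C_def
        by (metis closure_of_eq_empty countable_empty topspace_mtopology)
      show "decseq C"
        unfolding C_def
        by (intro decseq_SucI closure_of_mono) (simp add: node_subset del: node_Cons)
      fix \<epsilon> :: real assume "\<epsilon> > 0"
      then obtain n where n: "inverse (Suc n) < \<epsilon>" using reals_Archimedean by blast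
      obtain a where "node (b n # p n) \<subseteq> mcball a (inverse (Suc (length (p n))))"
        using P[of "p n"] unfolding P_def by blast
      then have "C (Suc n) \<subseteq> mcball a (inverse (Suc n))"
        unfolding C_def by (intro closure_of_minimal closedin_mcball) simp
      also have "\<dots> \<subseteq> mcball a \<epsilon>" using n by (intro mcball_subset_concentric) auto
      finally show "\<exists>n a. C n \<subseteq> mcball a \<epsilon>" by blast
    qed
    then obtain x where x: "\<And>n. x \<in> C n" by blast
    \<comment> \<open>Going one level deeper removes the closure, because the closure of a child
      lies in its parent.\<close>
    have xn: "x \<in> node (p n)" for n
      using x[of "Suc n"] closure_node[of "b n" "p n"] by (auto simp: C_def)
    have "x \<in> B n \<longleftrightarrow> b n" for n
    proof
      assume "x \<in> B n"
      then obtain s where "length s = n" "x \<in> node (True # s)" unfolding B_def by blast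
      then have "True # s = p (Suc n)" using xn[of "Suc n"] by (intro node_inj[of _ _ x]) simp_all
      then show "b n" by simp
    next
      assume "b n"
      then have "x \<in> node (True # p n)" using xn[of "Suc n"] by simp
      then show "x \<in> B n" unfolding B_def using \<open>length (p n) = n\<close> by blast
    qed
    then show "\<exists>x\<in>M. \<forall>n. x \<in> B n \<longleftrightarrow> b n" using xn[of 0] node_M by blast
  qed
qed

section \<open>Decoding index sequences as limits\<close>

text \<open>The numbers \<open>a n x\<close> index points of a dense sequence \<open>D\<close>, and
  \<open>F x\<close> is their limit when they converge at a prescribed rate. Density gives each
  point such a code, and \<open>surj_a\<close> realises the code by some \<open>x\<close>.\<close>

lemma (in Metric_space) measurable_limit_coding:
  assumes "mcomplete" and "separable_space mtopology" and "M \<noteq> {}"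
    and a: "\<And>n. a n \<in> measurable N (count_space UNIV)"
    and surj_a: "\<And>g :: nat \<Rightarrow> nat. \<exists>x\<in>space N. \<forall>n. a n x = g n"
  obtains F where "F ` space N = M"
    "\<And>C. closedin mtopology C \<Longrightarrow> F -` C \<inter> space N \<in> sets N"
proof -
  obtain D' where D': "countable D'" "D' \<subseteq> M" "mtopology closure_of D' = M"
    using assms(2) unfolding separable_space_def by auto
  have "D' \<noteq> {}" using D'(3) assms(3) by auto
  then obtain D :: "nat \<Rightarrow> 'a" where D: "range D = D'"
    using D'(1) by (metis uncountable_def)
  have DM [simp]: "D k \<in> M" for k using D D'(2) by blast
  obtain y0 where y0: "y0 \<in> M" using assms(3) by blast
  define e :: "nat \<Rightarrow> real" where "e = (\<lambda>n. inverse (Suc n))"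
  have e_pos: "e n > 0" for n by (simp add: e_def)
  have small: "\<exists>n. 2 * e n < \<epsilon>" if "\<epsilon> > 0" for \<epsilon>
    using reals_Archimedean[of "\<epsilon>/2"] that by (simp add: e_def mult.commute)
  \<comment> \<open>The valid codes: by \<open>L_ex\<close> and \<open>G_I\<close> below, this
    condition holds exactly when some \<open>y\<close> satisfies \<open>L x y\<close>. Unlike the
    existence of a limit, it is visibly a countable conjunction of conditions on the
    indices.\<close>
  define G where "G = {x \<in> space N. \<forall>m n. d (D (a m x)) (D (a n x)) \<le> e m + e n}"
  define L where "L = (\<lambda>x y. y \<in> M \<and> (\<forall>n. d (D (a n x)) y \<le> e n))"
  \<comment> \<open>Invalid codes are sent to the fixed point \<open>y0\<close>; in a preimage they
    contribute either all of \<open>space N - G\<close> or nothing.\<close>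
  define F where "F = (\<lambda>x. if x \<in> G then SOME y. L x y else y0)"
  have L_ex: "\<exists>y. L x y" if x: "x \<in> G" for x
  proof -
    define T where "T = (\<lambda>n. D (a n x))"
    have T: "d (T m) (T n) \<le> e m + e n" for m n using x by (simp add: G_def T_def)
    have T_M: "T n \<in> M" for n by (simp add: T_def)
    have "MCauchy T"
      unfolding MCauchy_def
    proof (intro conjI allI impI)
      show "range T \<subseteq> M" using T_M by blast
      fix \<epsilon> :: real assume "\<epsilon> > 0"
      then obtain k where k: "2 * e k < \<epsilon>" using small by blast
      have "d (T m) (T n) < \<epsilon>" if "k \<le> m" "k \<le> n" for m n
      proof -
        have "e m \<le> e k" "e n \<le> e k" using that by (auto simp: e_def field_simps)
        then show ?thesis using T[of m n] k by linarith
      qed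
      then show "\<exists>N. \<forall>n n'. N \<le> n \<longrightarrow> N \<le> n' \<longrightarrow> d (T n) (T n') < \<epsilon>" by blast
    qed
    then obtain y where y: "limitin mtopology T y sequentially"
      using assms(1) unfolding mcomplete_def by blast
    then have yM: "y \<in> M" using limitin_mspace by blast
    have "d (T n) y \<le> e n" for n
    proof (rule field_le_epsilon)
      fix \<epsilon> :: real assume \<epsilon>: "\<epsilon> > 0"
      obtain k where k: "2 * e k < \<epsilon>" using small \<epsilon> by blast
      have "e k > 0" by (rule e_pos)
      then obtain j where j: "\<And>m. m \<ge> j \<Longrightarrow> d (T m) y < e k"
        using y unfolding limit_metric_sequentially by blast
      \<comment> \<open>Beyond \<open>j\<close> the term is within \<open>e k\<close> of the limit,
        and beyond \<open>k\<close> its own tolerance is at most \<open>e k\<close>; the total error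
        \<open>2 * e k\<close> is below \<open>\<epsilon>\<close>.\<close>
      let ?m = "max j k"
      have "d (T n) y \<le> d (T n) (T ?m) + d (T ?m) y"
        by (intro triangle T_M yM)
      moreover have "e ?m \<le> e k" by (auto simp: e_def field_simps)
      ultimately show "d (T n) y \<le> e n + \<epsilon>"
        using T[of n ?m] j[of ?m] k by linarith
    qed
    then show ?thesis using yM unfolding L_def T_def by blast
  qed
  have L_F: "L x (F x)" if "x \<in> G" for x
    using L_ex[OF that] that unfolding F_def by (simp add: someI_ex)
  have F_M: "F x \<in> M" for x
    using L_F[of x] y0 by (cases "x \<in> G") (auto simp: L_def F_def)
  have L_unique: "y = z" if "L x y" "L x z" for x y z
  proof (rule ccontr)
    assume "y \<noteq> z"
    then have "d y z > 0" using that by (auto simp: L_def)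
    then obtain n where "2 * e n < d y z" using small by blast
    moreover have "d y z \<le> d y (D (a n x)) + d (D (a n x)) z"
      using that by (intro triangle) (auto simp: L_def)
    moreover have "d (D (a n x)) y \<le> e n" "d (D (a n x)) z \<le> e n"
      using that by (auto simp: L_def)
    ultimately show False using commute[of y "D (a n x)"] by linarith
  qed
  have G_I: "x \<in> G" if "x \<in> space N" "L x y" for x y
    unfolding G_def
  proof (intro CollectI conjI allI that(1))
    fix m n
    have "d (D (a m x)) (D (a n x)) \<le> d (D (a m x)) y + d y (D (a n x))"
      using that by (intro triangle) (auto simp: L_def)
    moreover have "d (D (a m x)) y \<le> e m" "d (D (a n x)) y \<le> e n"
      using that by (auto simp: L_def)
    ultimately show "d (D (a m x)) (D (a n x)) \<le> e m + e n"
      using commute[of y "D (a n x)"] by linarith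
  qed
  have surj: "y \<in> F ` space N" if y: "y \<in> M" for y
  proof -
    have "\<exists>k. d (D k) y \<le> e n" for n
    proof -
      have "y \<in> mtopology closure_of D'" using D' y by simp
      then obtain c where "c \<in> D'" "d y c < e n"
        using e_pos[of n] unfolding metric_closure_of by auto
      then show ?thesis using D commute[of y c] by (metis less_imp_le rangeE)
    qed
    then obtain g where g: "\<And>n. d (D (g n)) y \<le> e n" by metis
    obtain x where x: "x \<in> space N" "\<And>n. a n x = g n" using surj_a by blast
    have "L x y" using x g y by (simp add: L_def)
    then have "F x = y" using L_unique L_F G_I x(1) by blast
    then show ?thesis using x(1) by blast
  qed
  note a[measurable]
  have G_meas: "G \<in> sets N"
  proof -
    have [measurable]: "Measurable.pred N (\<lambda>x. d (D (a m x)) (D (a n x)) \<le> e m + e n)" for m n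
    proof -
      \<comment> \<open>The pair takes values in a countable discrete space, on which every
        predicate is measurable.\<close>
      have "(\<lambda>x. (a m x, a n x)) \<in> measurable N (count_space UNIV)"
        using measurable_Pair[OF a[of m] a[of n]]
        by (simp add: pair_measure_countable)
      from measurable_compose[OF this, of "\<lambda>(i, j). d (D i) (D j) \<le> e m + e n" "count_space UNIV"]
      show ?thesis by simp
    qed
    show ?thesis unfolding G_def by measurable
  qed
  show ?thesis
  proof
    show "F ` space N = M" using surj F_M by blast
    fix C assume C: "closedin mtopology C"
    define K where "K = (\<lambda>n. {k. \<exists>c\<in>C. d (D k) c \<le> e n})"
    \<comment> \<open>As \<open>F x\<close> is approximated by the countably valued \<open>D (a n x)\<close>, membership in a closed
      set is a countable intersection of conditions on the \<open>a n x\<close>.\<close>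
    have eq: "F x \<in> C \<longleftrightarrow> (\<forall>n. a n x \<in> K n)" if x: "x \<in> G" for x
    proof
      assume "F x \<in> C"
      then show "\<forall>n. a n x \<in> K n" using L_F[OF x] by (auto simp: K_def L_def)
    next
      assume *: "\<forall>n. a n x \<in> K n"
      show "F x \<in> C"
      proof (rule ccontr)
        assume "F x \<notin> C"
        \<comment> \<open>Closedness enters here: a ball around \<open>F x\<close> misses
          \<open>C\<close>, yet both \<open>F x\<close> and some point of \<open>C\<close> are
          within \<open>e n\<close> of \<open>D (a n x)\<close>.\<close>
        then obtain r where r: "r > 0" "disjnt C (mball (F x) r)"
          using C F_M unfolding closedin_metric by blast
        obtain n where n: "2 * e n < r" using small r(1) by blast
        obtain c where c: "c \<in> C" "d (D (a n x)) c \<le> e n" using * by (auto simp: K_def)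
        have cM: "c \<in> M" using C c(1) closedin_metric by blast
        have "d (F x) c \<le> d (F x) (D (a n x)) + d (D (a n x)) c"
          by (intro triangle F_M cM DM)
        moreover have "d (D (a n x)) (F x) \<le> e n" using L_F[OF x] by (simp add: L_def)
        ultimately have "d (F x) c < r" using c n commute[of "F x" "D (a n x)"] by linarith
        then show False using r c(1) cM F_M by (auto simp: disjnt_iff)
      qed
    qed
    have "F -` C \<inter> space N = (if y0 \<in> C then space N - G else {}) \<union>
        (G \<inter> {x \<in> space N. \<forall>n. a n x \<in> K n})"
    proof -
      have "G \<subseteq> space N" by (auto simp: G_def)
      moreover have "F x = y0" if "x \<notin> G" for x using that by (simp add: F_def)
      ultimately show ?thesis using eq by (auto split: if_splits)
    qed
    also have "\<dots> \<in> sets N"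
    proof (intro sets.Un sets.Int G_meas)
      show "(if y0 \<in> C then space N - G else {}) \<in> sets N" using G_meas by auto
      show "{x \<in> space N. \<forall>n. a n x \<in> K n} \<in> sets N" by measurable
    qed
    finally show "F -` C \<inter> space N \<in> sets N" .
  qed
qed

section \<open>Borel surjections between Polish spaces\<close>

lemma Polish_space_Borel_surjection:
  assumes X: "Polish_space X" "uncountable (topspace X)"
    and Y: "Polish_space Y" "topspace Y \<noteq> {}"
  obtains F where "F ` topspace X = topspace Y"
    "\<And>A. A \<in> Borel_sets Y \<Longrightarrow> F -` A \<inter> topspace X \<in> Borel_sets X"
proof -
  \<comment> \<open>Only the sigma-algebra of \<open>N\<close> matters; it packages the Borel sets
    for measurability arguments.\<close>
  define N where "N = sigma (topspace X) {U. openin X U}"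
  have space_N: "space N = topspace X" by (simp add: N_def space_measure_of_conv)
  have "{U. openin X U} \<subseteq> Pow (topspace X)" using openin_subset by blast
  then have sets_N: "sets N = Borel_sets X" by (simp add: N_def Borel_sets_def)
  have open_N: "U \<in> sets N" if "openin X U" for U
    using that by (auto simp: sets_N Borel_sets_def)
  obtain M d where M: "Metric_space M d" "Metric_space.mcomplete M d"
      "X = Metric_space.mtopology M d"
    using X(1) unfolding Polish_space_def completely_metrizable_space_def by blast
  interpret X: Metric_space M d by (rule M)
  have sep_X: "separable_space X.mtopology" and unc_X: "uncountable M"
    using X M(3) by (auto simp: Polish_space_def)
  obtain B :: "nat \<Rightarrow> 'a set"
    where B: "\<And>n. openin X (B n)" "\<And>b. \<exists>x\<in>M. \<forall>n. x \<in> B n \<longleftrightarrow> b n"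
    using X.independent_open_sequence[OF M(2) sep_X unc_X, folded M(3)] by blast
  \<comment> \<open>The pattern of \<open>x\<close> is read as a double array through
    \<open>prod_encode\<close>, and \<open>a n x\<close> is the first hit in row \<open>n\<close>. A
    pattern whose row \<open>n\<close> is hit only at \<open>g n\<close> therefore codes
    \<open>g\<close>. An empty row yields some fixed number.\<close>
  define a where "a = (\<lambda>n x. LEAST k. x \<in> B (prod_encode (n, k)))"
  have a: "a n \<in> measurable N (count_space UNIV)" for n
  proof -
    have [measurable]: "B m \<in> sets N" for m using B(1) open_N by blast
    show ?thesis unfolding a_def by measurable
  qed
  have surj_a: "\<exists>x\<in>space N. \<forall>n. a n x = g n" for g :: "nat \<Rightarrow> nat"
  proof -
    obtain x where x: "x \<in> M" "\<And>m. x \<in> B m \<longleftrightarrow> (case prod_decode m of (n, k) \<Rightarrow> k = g n)"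
      using B(2)[of "\<lambda>m. case prod_decode m of (n, k) \<Rightarrow> k = g n"] by blast
    then show ?thesis
      by (intro bexI[of _ x]) (auto simp: a_def space_N M(3) intro: Least_equality)
  qed
  obtain M' d' where M': "Metric_space M' d'" "Metric_space.mcomplete M' d'"
      "Y = Metric_space.mtopology M' d'"
    using Y(1) unfolding Polish_space_def completely_metrizable_space_def by blast
  interpret Y: Metric_space M' d' by (rule M')
  have sep_Y: "separable_space Y.mtopology" and nonempty_Y: "M' \<noteq> {}"
    using Y M'(3) by (auto simp: Polish_space_def)
  obtain F where F: "F ` space N = M'"
      "\<And>C. closedin Y C \<Longrightarrow> F -` C \<inter> space N \<in> sets N"
    using Y.measurable_limit_coding[OF M'(2) sep_Y nonempty_Y a surj_a, folded M'(3)] by blast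
  \<comment> \<open>Measurability is checked on the open generators, whose preimages are complements
    of preimages of closed sets.\<close>
  have "F \<in> measurable N (sigma (topspace Y) {U. openin Y U})"
  proof (rule measurable_measure_of)
    show "{U. openin Y U} \<subseteq> Pow (topspace Y)" using openin_subset by blast
    show F_Y: "F \<in> space N \<rightarrow> topspace Y" using F(1) M'(3) by auto
    fix U assume "U \<in> {U. openin Y U}"
    then have "F -` (topspace Y - U) \<inter> space N \<in> sets N" by (intro F(2)) auto
    moreover have "F -` U \<inter> space N = space N - (F -` (topspace Y - U) \<inter> space N)"
      using F_Y by auto
    ultimately show "F -` U \<inter> space N \<in> sets N" by auto
  qed
  moreover have "sets (sigma (topspace Y) {U. openin Y U}) = Borel_sets Y"
    unfolding Borel_sets_def by (rule sets_measure_of) (use openin_subset in blast)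
  ultimately have "F -` A \<inter> topspace X \<in> Borel_sets X" if "A \<in> Borel_sets Y" for A
    using that measurable_sets space_N sets_N by metis
  moreover have "F ` topspace X = topspace Y" using F(1) space_N M'(3) by simp
  ultimately show ?thesis using that by blast
qed

section \<open>Pulling back partitions and comparing the spectra\<close>

text \<open>By surjectivity, the image under \<open>F\<close> of the preimage of a piece is the
  piece itself. Hence preimages of pieces are nonempty and distinct, and the number of pieces is
  preserved.\<close>

lemma Borel_partition_vimage:
  assumes F: "F ` topspace X = topspace Y"
      "\<And>A. A \<in> Borel_sets Y \<Longrightarrow> F -` A \<inter> topspace X \<in> Borel_sets X"
    and P: "Borel_partition Y P"
  obtains Q where "Borel_partition X Q" "|Q| =o |P|"
proof -
  define h where "h = (\<lambda>A. F -` A \<inter> topspace X)"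
  have U: "\<Union>P = topspace Y" "{} \<notin> P" "disjoint P" "P \<subseteq> Borel_sets Y"
    using P by (auto simp: Borel_partition_def partition_on_def)
  have image_h: "F ` h A = A" if "A \<in> P" for A
  proof -
    have "A \<subseteq> F ` topspace X" using that U(1) F(1) by blast
    then show ?thesis by (auto simp: h_def)
  qed
  have "inj_on h P" by (metis image_h inj_onI)
  then have "|h ` P| =o |P|"
    by (intro ordIso_symmetric[OF card_of_ordIsoI[OF inj_on_imp_bij_betw]])
  moreover have "Borel_partition X (h ` P)"
    unfolding Borel_partition_def
  proof
    show "partition_on (topspace X) (h ` P)"
    proof (rule partition_onI)
      show "\<Union>(h ` P) = topspace X"
      proof -
        have "F -` \<Union>P \<inter> topspace X = topspace X" using U(1) F(1) by auto
        then show ?thesis by (auto simp: h_def)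
      qed
      show "{} \<notin> h ` P" using image_h U(2) by fastforce
      show "disjnt p q" if "p \<in> h ` P" "q \<in> h ` P" "p \<noteq> q" for p q
        using that U(3) by (auto simp: h_def disjnt_def disjoint_def)
    qed
    show "h ` P \<subseteq> Borel_sets X" using F(2) U(4) by (auto simp: h_def)
  qed
  ultimately show ?thesis using that by blast
qed

lemma Polish_space_euclidean:
  "Polish_space (euclidean :: 'a :: {complete_space, second_countable_topology} topology)"
proof -
  obtain D :: "'a set" where D: "countable D" "\<And>T. open T \<Longrightarrow> T \<noteq> {} \<Longrightarrow> \<exists>d\<in>D. d \<in> T"
    using countable_dense_setE by blast
  have "euclidean closure_of D = topspace euclidean"
    unfolding dense_intersects_open using D(2) by fastforce
  then show ?thesis
    using D(1) completely_metrizable_space_euclidean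
    unfolding Polish_space_def separable_space_def by auto
qed

lemma uncountable_iff_natLeq_ordLess: "uncountable A \<longleftrightarrow> natLeq <o |A|"
  unfolding countable_card_le_natLeq
  by (rule not_ordLeq_iff_ordLess[OF natLeq_Well_order card_of_Well_order])

theorem theorem2p1:
  fixes X :: "'a topology"
  assumes "Polish_space X" and "uncountable (topspace X)"
  shows "(sp_Borel :: 'k rel set) =
    {\<kappa>. Card_order \<kappa> \<and> natLeq <o \<kappa> \<and> (\<exists>Q. Borel_partition X Q \<and> |Q| =o \<kappa>)}"
proof -
  let ?R = "euclidean :: real topology"
  have R: "Polish_space ?R" "uncountable (topspace ?R)"
    using Polish_space_euclidean uncountable_UNIV_real by auto
  have nonempty: "topspace X \<noteq> {}" "topspace ?R \<noteq> {}"
    using assms(2) by auto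
  \<comment> \<open>A surjection from \<open>X\<close> onto the line carries partitions of the line
    to \<open>X\<close>; an independently chosen surjection from the line onto \<open>X\<close>
    serves the other direction.\<close>
  have "\<exists>Q. Borel_partition X Q \<and> |Q| =o |P|" if "Borel_partition ?R P" for P
    using Polish_space_Borel_surjection[OF assms R(1) nonempty(2)] Borel_partition_vimage[OF _ _ that]
    by metis
  moreover have "\<exists>P. Borel_partition ?R P \<and> |P| =o |Q|" if "Borel_partition X Q" for Q
    using Polish_space_Borel_surjection[OF R assms(1) nonempty(1)] Borel_partition_vimage[OF _ _ that]
    by metis
  moreover have "uncountable P \<longleftrightarrow> natLeq <o \<kappa>" if "|P| =o \<kappa>" for P :: "real set set" and \<kappa> :: "'k rel"
    using that uncountable_iff_natLeq_ordLess
    by (meson ordIso_symmetric ordLess_ordIso_trans)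
  ultimately show ?thesis
    unfolding sp_Borel_def by (intro Collect_cong) (metis ordIso_transitive)
qed

end
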